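(* Let $\mathscr{A}$ be a complex Banach algebra with unit $1$. Let $a\in\mathscr{A}$ and let $p,q\in\mathscr{A}$ be idempotents such that $a^{(2,l)}_{p,q}$ exists, and put $\kappa=\|a\|\,\|a^{(2,l)}_{p,q}\|$. Suppose that $q'\in\mathscr{A}$ is an idempotent with $\|q-q'\|<\dfrac{1}{2+\kappa}$. Then $a^{(2,l)}_{p,q'}$ exists and: (1) $\dfrac{\|a^{(2,l)}_{p,q'}-a^{(2,l)}_{p,q}\|}{\|a^{(2,l)}_{p,q}\|}\le\dfrac{(1+\kappa)\|q-q'\|}{1-\kappa\|q-q'\|}$ and $\|a^{(2,l)}_{p,q'}\|\le\dfrac{1+\|q'-q\|}{1-\kappa\|q'-q\|}\,\|a^{(2,l)}_{p,q}\|$. (2) If $w,v\in\mathscr{A}$ satisfy $R_r(w)=R_r(v)=R_r(p)$, $K_r(w)=R_r(q)$ and $K_r(v)=R_r(q')$, then $$a^{(2,l)}_{p,q'}=a^{(2,l)}_{p,q}+a^{(2,l)}_{p,q}(av)^{(1,5)}a(v-w)(1-a\,a^{(2,l)}_{p,q}).$$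
   Context: For $x\in\mathscr{A}$ let $R_r(x)=\{xy: y\in\mathscr{A}\}$ and $K_r(x)=\{y\in\mathscr{A}: xy=0\}$. For $a\in\mathscr{A}$ and idempotents $p,q\in\mathscr{A}$, the $(p,q,l)$-outer generalized inverse $a^{(2,l)}_{p,q}$ is an element $b\in\mathscr{A}$ with $bab=b$, $R_r(b)=R_r(p)$, $K_r(b)=R_r(q)$; it is unique if it exists. For $c\in\mathscr{A}$, $c^{(1,5)}$ denotes a $(1,5)$-inverse of $c$, i.e. an element $g\in\mathscr{A}$ with $cgc=c$ and $cg=gc$ (not necessarily unique). *)

theory Defs
  imports "HOL-Analysis.Analysis"
begin

text \<open>
  The norm of the unit is not required to be 1 (nor is the zero algebra excluded), so the class
  covers every convention for a complex Banach algebra with unit. Together with the inherited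
  real structure, the axioms say that \<open>scaleC\<close> is a complex vector space structure extending
  \<open>scaleR\<close>; the law \<open>scaleC 1 x = x\<close> follows from \<open>scaleR_scaleC\<close>.
\<close>

class complex_banach_algebra_unit = real_normed_algebra + monoid_mult + banach +
  fixes scaleC :: "complex \<Rightarrow> 'a \<Rightarrow> 'a"
  assumes scaleR_scaleC: "scaleR r x = scaleC (Complex r 0) x"
    and scaleC_add_right: "scaleC \<alpha> (x + y) = scaleC \<alpha> x + scaleC \<alpha> y"
    and scaleC_add_left: "scaleC (\<alpha> + \<beta>) x = scaleC \<alpha> x + scaleC \<beta> x"
    and scaleC_scaleC: "scaleC \<alpha> (scaleC \<beta> x) = scaleC (\<alpha> * \<beta>) x"
    and mult_scaleC_left: "scaleC \<alpha> x * y = scaleC \<alpha> (x * y)"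
    and mult_scaleC_right: "x * scaleC \<alpha> y = scaleC \<alpha> (x * y)"
    and norm_scaleC: "norm (scaleC \<alpha> x) = cmod \<alpha> * norm x"

definition right_range :: "'a::ring \<Rightarrow> 'a set"
  where "right_range x = {x * y | y. True}"

definition right_kernel :: "'a::ring \<Rightarrow> 'a set"
  where "right_kernel x = {y. x * y = 0}"

definition is_outer_inv_2l :: "'a::ring \<Rightarrow> 'a \<Rightarrow> 'a \<Rightarrow> 'a \<Rightarrow> bool"
  where "is_outer_inv_2l a p q b \<longleftrightarrow>
    b * a * b = b \<and> right_range b = right_range p \<and> right_kernel b = right_range q"

text \<open>Meaningful only if such an element exists; it is then unique, as shown next.\<close>

definition outer_inv_2l :: "'a::ring \<Rightarrow> 'a \<Rightarrow> 'a \<Rightarrow> 'a"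
  where "outer_inv_2l a p q = (THE b. is_outer_inv_2l a p q b)"

lemma is_outer_inv_2l_unique:
  fixes a :: "'a::{ring, monoid_mult}"
  assumes b: "is_outer_inv_2l a p q b" and c: "is_outer_inv_2l a p q c"
  shows "b = c"
proof -
  have "b * 1 \<in> right_range b"
    unfolding right_range_def by blast
  then have "b \<in> right_range c"
    using b c by (simp add: is_outer_inv_2l_def)
  then obtain s where s: "b = c * s"
    by (auto simp: right_range_def)
  have "c * a * b = (c * a * c) * s"
    by (simp add: s mult.assoc)
  then have 1: "c * a * b = b"
    using c s by (simp add: is_outer_inv_2l_def)
  have "b * (1 - a * b) = 0"
    using b by (simp add: is_outer_inv_2l_def right_diff_distrib mult.assoc)
  then have "1 - a * b \<in> right_kernel b"
    by (simp add: right_kernel_def)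
  then have "1 - a * b \<in> right_kernel c"
    using b c by (simp add: is_outer_inv_2l_def)
  then have "c * a * b = c"
    by (simp add: right_kernel_def right_diff_distrib mult.assoc)
  with 1 show ?thesis
    by simp
qed

lemma outer_inv_2l_eqI:
  fixes a :: "'a::{ring, monoid_mult}"
  assumes "is_outer_inv_2l a p q b"
  shows "outer_inv_2l a p q = b"
  unfolding outer_inv_2l_def
  using assms is_outer_inv_2l_unique by (blast intro: the_equality)

definition is_15_inverse :: "'a::ring \<Rightarrow> 'a \<Rightarrow> bool"
  where "is_15_inverse c g \<longleftrightarrow> c * g * c = c \<and> c * g = g * c"

end

theory Submission imports Defs begin

text \<open>
  Let \<open>b\<close> be the generalized inverse for \<open>q\<close> and \<open>f = a * b\<close>, an idempotent whose kernel is the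
  range of \<open>q\<close>. The element \<open>z = f + q' * (1 - f) = 1 - (q - q') * (1 - f)\<close> is invertible because
  \<open>norm (q - q') * (1 + \<kappa>) < 1\<close>; it fixes the range of \<open>f\<close> and maps the range of \<open>q\<close> onto that of
  \<open>q'\<close>, so \<open>b' = b * inverse z\<close> is the generalized inverse for \<open>q'\<close>. The sharp bounds do not come
  from this formula but from the identity \<open>b - b' = b * (q' - q) * (1 - a * b')\<close>. Finally, every
  (1,5)-inverse \<open>g\<close> of \<open>a * v\<close> satisfies \<open>g * a * v = a * b'\<close>, which gives the representation in (2).
\<close>

section \<open>Right ranges in a unital ring\<close>

lemma right_range_self: "(x::'a::{ring, monoid_mult}) \<in> right_range x"
  unfolding right_range_def by (metis (mono_tags, lifting) mem_Collect_eq mult_1_right)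

lemma right_range_absorb:
  fixes x q :: "'a::{ring, monoid_mult}"
  assumes "q * q = q" and "x \<in> right_range q"
  shows "q * x = x"
  using assms by (auto simp: right_range_def mult.assoc[symmetric])

lemma right_range_mult_subset: "right_range (x * y) \<subseteq> right_range (x::'a::ring)"
  by (auto simp: right_range_def mult.assoc)

section \<open>Identities for a given outer inverse \<open>b\<close>\<close>

context
  fixes a p q b :: "'a::{ring, monoid_mult}"
  assumes b: "is_outer_inv_2l a p q b"
begin

lemma outer_inv_inner: "b * (a * b) = b"
  using b by (simp add: is_outer_inv_2l_def mult.assoc)

lemma outer_inv_mult_q: "b * q = 0"
  using b right_range_self[of q] by (auto simp: is_outer_inv_2l_def right_kernel_def)

lemma outer_inv_q_mult:
  assumes "q * q = q"
  shows "q * (1 - a * b) = 1 - a * b"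
proof -
  have "b * (1 - a * b) = 0"
    by (simp add: right_diff_distrib outer_inv_inner)
  then have "1 - a * b \<in> right_range q"
    using b by (auto simp: is_outer_inv_2l_def right_kernel_def)
  with assms show ?thesis
    by (rule right_range_absorb)
qed

text \<open>\<open>v\<close> lies in the range of \<open>b\<close>, where \<open>b * a\<close> acts
  as the identity because \<open>b * a * b = b\<close>.\<close>

lemma outer_inv_mult_range:
  assumes "right_range v = right_range p"
  shows "b * (a * v) = v"
proof -
  have "v \<in> right_range b"
    using b assms right_range_self[of v] by (simp add: is_outer_inv_2l_def)
  then obtain s where "v = b * s"
    by (auto simp: right_range_def)
  then show ?thesis
    using b by (simp add: is_outer_inv_2l_def mult.assoc[symmetric])
qed

lemma kernel_mult_outer_inv:
  assumes "right_kernel v = right_range q"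
  shows "v * (a * b) = v"
proof -
  have "1 - a * b \<in> right_kernel b"
    by (simp add: right_kernel_def right_diff_distrib outer_inv_inner)
  then have "1 - a * b \<in> right_kernel v"
    using b assms by (simp add: is_outer_inv_2l_def)
  then show ?thesis
    by (simp add: right_kernel_def right_diff_distrib)
qed

text \<open>The inverses \<open>zi\<close> and \<open>y\<close> enter as hypotheses, which keeps the
  argument purely algebraic; the norm bounds that produce them come later.\<close>

lemma outer_inv_perturbed:
  assumes q: "q * q = q" and q': "q' * q' = q'"
    and z: "(1 - (q - q') * (1 - a * b)) * zi = 1" "zi * (1 - (q - q') * (1 - a * b)) = 1"
    and y: "(1 - (q' - q)) * y = 1"
  shows "is_outer_inv_2l a p q' (b * zi)"
proof -
  define e where "e = 1 - a * b"
  define u where "u = 1 - (q - q') * e"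
  have zi: "u * zi = 1" "zi * u = 1"
    using z by (simp_all add: u_def e_def)
  have be: "b * e = 0"
    by (simp add: e_def right_diff_distrib outer_inv_inner)
  have qe: "q * e = e"
    using outer_inv_q_mult[OF q] by (simp add: e_def)
  have ee: "e * e = e"
    using be by (simp add: e_def left_diff_distrib mult.assoc)
  have eq: "e * q = q"
    by (simp add: e_def left_diff_distrib mult.assoc outer_inv_mult_q)
  have "e * (a * b) = 0"
    by (simp add: e_def left_diff_distrib mult.assoc outer_inv_inner)
  then have "u * (a * b) = a * b"
    by (simp add: u_def left_diff_distrib mult.assoc)
  then have zi_f: "zi * (a * b) = a * b"
    by (metis zi(2) mult.assoc mult_1_left)
  \<comment> \<open>On the range of \<open>q\<close>, which is the range of \<open>e\<close>, the
    element \<open>u\<close> acts as \<open>q'\<close>.\<close>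
  have ue: "u * e = q' * e"
    by (simp add: u_def left_diff_distrib mult.assoc ee qe)
  have zi_q'e: "zi * (q' * e) = e"
    by (metis ue zi(2) mult.assoc mult_1_left)
  \<comment> \<open>With \<open>e * q = q\<close> this puts \<open>q'\<close> into the range of
    \<open>q' * e\<close>, so that \<open>u\<close> maps the range of \<open>q\<close> onto all of
    the range of \<open>q'\<close>.\<close>
  have "q' * q * y = q'"
  proof -
    have "q' * q = q' * (1 - (q' - q))"
      by (simp add: algebra_simps q')
    then show ?thesis
      using y by (simp add: mult.assoc)
  qed
  then have q'_e: "q' = q' * e * (q * y)"
    by (metis eq mult.assoc)
  have "b * zi * a * (b * zi) = b * (zi * (a * b)) * zi"
    by (simp add: mult.assoc)
  then have outer: "b * zi * a * (b * zi) = b * zi"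
    by (simp add: zi_f outer_inv_inner)
  have "b = b * zi * u"
    by (simp add: mult.assoc zi)
  then have "right_range b \<subseteq> right_range (b * zi)"
    using right_range_mult_subset[of "b * zi" u] by simp
  then have range: "right_range (b * zi) = right_range b"
    using right_range_mult_subset[of b zi] by blast
  have "b * zi * q' = b * (zi * (q' * e)) * (q * y)"
    using q'_e by (metis mult.assoc)
  then have bzq: "b * zi * q' = 0"
    by (simp add: zi_q'e be)
  have kernel: "right_kernel (b * zi) = right_range q'"
  proof (intro equalityI subsetI)
    fix x assume "x \<in> right_kernel (b * zi)"
    then have "b * (zi * x) = 0"
      by (simp add: right_kernel_def mult.assoc)
    \<comment> \<open>\<open>zi * x\<close> lies in the kernel of \<open>b\<close>, hence is fixed
      by \<open>e\<close>; applying \<open>u\<close> to it recovers \<open>x\<close> and brings in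
      the factor \<open>q'\<close>.\<close>
    then have "e * (zi * x) = zi * x"
      by (simp add: e_def left_diff_distrib mult.assoc)
    then have "x = u * e * (zi * x)"
      by (metis zi(1) mult.assoc mult_1_left)
    then have "x = q' * (e * (zi * x))"
      by (simp add: ue mult.assoc)
    then show "x \<in> right_range q'"
      by (auto simp: right_range_def)
  next
    fix x assume "x \<in> right_range q'"
    then show "x \<in> right_kernel (b * zi)"
      using bzq by (auto simp: right_range_def right_kernel_def mult.assoc[symmetric])
  qed
  show ?thesis
    using b outer range kernel by (simp add: is_outer_inv_2l_def)
qed

section \<open>(1,5)-inverses of \<open>a * v\<close>\<close>

context
  fixes v :: 'a
  assumes range_v: "right_range v = right_range p"
    and kernel_v: "right_kernel v = right_range q"
begin

text \<open>Multiplying by \<open>b\<close> turns \<open>a * v * x = 0\<close> into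
  \<open>v * x = 0\<close>, and \<open>v\<close> and \<open>b\<close> have the same kernel. This is
  left cancellation of \<open>a * v\<close>, up to the idempotent \<open>a * b\<close>.\<close>

lemma outer_inv_cancel:
  assumes "a * v * x = 0"
  shows "a * b * x = 0"
proof -
  have "b * (a * v) * x = b * (a * v * x)"
    by (simp only: mult.assoc)
  then have "v * x = 0"
    using assms outer_inv_mult_range[OF range_v] by simp
  then have "x \<in> right_kernel b"
    using b kernel_v by (auto simp: is_outer_inv_2l_def right_kernel_def)
  then show ?thesis
    by (simp add: right_kernel_def mult.assoc)
qed

text \<open>\<open>a * v\<close> is invertible in the corner ring of the idempotent
  \<open>f = a * b\<close>, whose unit is \<open>f\<close>; its inverse there is a
  (1,5)-inverse.\<close>

lemma outer_inv_15_inverse_exists: "\<exists>g. is_15_inverse (a * v) g"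
proof -
  define f where "f = a * b"
  have ff: "f * f = f"
    by (simp add: f_def mult.assoc outer_inv_inner)
  have cf: "a * v * f = a * v"
    using kernel_mult_outer_inv[OF kernel_v] by (simp add: f_def mult.assoc)
  have fc: "f * (a * v) = a * v"
    using outer_inv_mult_range[OF range_v] by (simp add: f_def mult.assoc)
  have "b \<in> right_range v"
    using b range_v right_range_self[of b] by (simp add: is_outer_inv_2l_def)
  then obtain t where t: "b = v * t"
    by (auto simp: right_range_def)
  \<comment> \<open>\<open>t\<close> is a right inverse of \<open>a * v\<close> relative to
    \<open>f\<close>; multiplying it by \<open>f\<close> on both sides moves it into the
    corner.\<close>
  define g where "g = f * t * f"
  have "a * v * t = f"
    by (simp add: f_def t mult.assoc)
  then have cg: "a * v * g = f"
    by (metis g_def cf ff mult.assoc)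
  have fg: "f * g = g"
    by (simp add: g_def ff mult.assoc[symmetric])
  have "a * v * (g * (a * v) - f) = a * v * g * (a * v) - a * v * f"
    by (simp only: right_diff_distrib mult.assoc)
  also have "\<dots> = 0"
    by (simp only: cg fc cf diff_self)
  finally have "f * (g * (a * v) - f) = 0"
    unfolding f_def by (rule outer_inv_cancel)
  moreover have "f * (g * (a * v) - f) = g * (a * v) - f"
    by (simp add: right_diff_distrib ff fg mult.assoc[of f g, symmetric])
  ultimately have "g * (a * v) = f"
    by simp
  then have "is_15_inverse (a * v) g"
    using cg fc by (simp add: is_15_inverse_def)
  then show ?thesis ..
qed

text \<open>Cancellation gives \<open>f = f * (g * c)\<close>. Commutation rewrites
  \<open>g * c\<close> as \<open>c * g\<close>, which \<open>f\<close> fixes from the left since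
  \<open>f * c = c\<close>.\<close>

lemma outer_inv_15_inverse_mult:
  assumes g: "is_15_inverse (a * v) g"
  shows "g * (a * v) = a * b"
proof -
  define f c where "f = a * b" and "c = a * v"
  have cgc: "c * g * c = c" "c * g = g * c"
    using g unfolding is_15_inverse_def c_def by blast+
  have ff: "f * f = f"
    by (simp add: f_def mult.assoc outer_inv_inner)
  have cf: "c * f = c"
    using kernel_mult_outer_inv[OF kernel_v] by (simp add: f_def c_def mult.assoc)
  have fc: "f * c = c"
    using outer_inv_mult_range[OF range_v] by (simp add: f_def c_def mult.assoc)
  have "c * (f - g * c) = 0"
    by (simp add: right_diff_distrib cf cgc(1) mult.assoc[symmetric])
  then have "f * (f - g * c) = 0"
    unfolding f_def c_def by (rule outer_inv_cancel)
  then have "f = f * (g * c)"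
    by (simp add: right_diff_distrib ff)
  also have "\<dots> = g * c"
    by (metis cgc(2) fc mult.assoc)
  finally show ?thesis
    by (simp add: f_def c_def)
qed

end

end

section \<open>Invertibility of \<open>1 - u\<close> for \<open>norm u < 1\<close>\<close>

lemma right_inverse_one_minus:
  fixes u :: "'a::{real_normed_algebra, monoid_mult, banach}"
  assumes "norm u < 1"
  shows "\<exists>y. (1 - u) * y = 1"
proof -
  \<comment> \<open>A fixed point of this contraction is a right inverse of \<open>1 - u\<close>;
    the argument is independent of the norm of \<open>1\<close>.\<close>
  have "\<exists>!x. 1 + u * x = x"
  proof (rule banach_fix_type[where c = "norm u"])
    show "\<forall>x y. dist (1 + u * x) (1 + u * y) \<le> norm u * dist x y"
      by (simp add: dist_norm right_diff_distrib[symmetric] norm_mult_ineq)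
  qed (use assms in auto)
  then obtain x where "1 + u * x = x"
    by blast
  then have "(1 - u) * x = 1"
    by (simp add: left_diff_distrib diff_eq_eq)
  then show ?thesis ..
qed

lemma left_inverse_one_minus:
  fixes u :: "'a::{real_normed_algebra, monoid_mult, banach}"
  assumes "norm u < 1"
  shows "\<exists>y. y * (1 - u) = 1"
proof -
  have "\<exists>!x. 1 + x * u = x"
  proof (rule banach_fix_type[where c = "norm u"])
    show "\<forall>x y. dist (1 + x * u) (1 + y * u) \<le> norm u * dist x y"
      by (simp add: dist_norm left_diff_distrib[symmetric] norm_mult_ineq mult.commute[of "norm u"])
  qed (use assms in auto)
  then obtain x where "1 + x * u = x"
    by blast
  then have "x * (1 - u) = 1"
    by (simp add: right_diff_distrib diff_eq_eq)
  then show ?thesis ..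
qed

lemma inverse_one_minus:
  fixes u :: "'a::{real_normed_algebra, monoid_mult, banach}"
  assumes "norm u < 1"
  shows "\<exists>y. (1 - u) * y = 1 \<and> y * (1 - u) = 1"
proof -
  obtain x y where "(1 - u) * x = 1" "y * (1 - u) = 1"
    using left_inverse_one_minus[OF assms] right_inverse_one_minus[OF assms] by blast
  then show ?thesis
    by (metis mult.assoc mult_1_left mult_1_right)
qed

text \<open>Distributing before taking norms yields the constant \<open>1\<close> even if
  \<open>norm 1\<close> exceeds 1.\<close>

lemma norm_mult_one_minus_le:
  fixes x y :: "'a::{real_normed_algebra, monoid_mult}"
  shows "norm (x * (1 - y)) \<le> norm x * (1 + norm y)"
proof -
  have "norm (x * (1 - y)) \<le> norm x + norm (x * y)"
    by (simp add: right_diff_distrib norm_triangle_ineq4)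
  also have "\<dots> \<le> norm x + norm x * norm y"
    by (simp add: norm_mult_ineq)
  finally show ?thesis
    by (simp add: distrib_left)
qed

text \<open>The bound makes both \<open>(q - q') * (1 - a * b)\<close> and \<open>q' - q\<close>
  have norm below 1, which supplies the inverses \<open>zi\<close> and \<open>y\<close>.\<close>

lemma outer_inv_perturbed_exists:
  fixes a p q q' b :: "'a::{real_normed_algebra, monoid_mult, banach}"
  assumes b: "is_outer_inv_2l a p q b" and "q * q = q" "q' * q' = q'"
    and small: "norm (q - q') * (1 + norm a * norm b) < 1"
  shows "\<exists>b'. is_outer_inv_2l a p q' b'"
proof -
  have "norm ((q - q') * (1 - a * b)) \<le> norm (q - q') * (1 + norm (a * b))"
    by (rule norm_mult_one_minus_le)
  also have "\<dots> \<le> norm (q - q') * (1 + norm a * norm b)"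
    by (intro mult_left_mono add_left_mono norm_mult_ineq norm_ge_zero)
  finally have "norm ((q - q') * (1 - a * b)) < 1"
    using small by simp
  moreover have "norm (q - q') * 1 \<le> norm (q - q') * (1 + norm a * norm b)"
    by (intro mult_left_mono) simp_all
  then have "norm (q' - q) < 1"
    using small by (simp add: norm_minus_commute)
  ultimately show ?thesis
    using outer_inv_perturbed[OF b] assms(2,3) inverse_one_minus right_inverse_one_minus by metis
qed

section \<open>Norm bounds for the perturbed inverse\<close>

context
  fixes a p q q' b b' :: "'a::{real_normed_algebra, monoid_mult}"
  assumes b: "is_outer_inv_2l a p q b" and b': "is_outer_inv_2l a p q' b'"
    and q': "q' * q' = q'"
    and small: "norm a * norm b * norm (q - q') < 1"
begin

lemma norm_outer_inv_diff_le_aux: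
  "norm (b' - b) \<le> norm b * norm (q - q') * (1 + norm a * norm b')"
proof -
  have "right_range b' = right_range p"
    using b' by (simp add: is_outer_inv_2l_def)
  then have "b' = b * (a * b')"
    using outer_inv_mult_range[OF b] by simp
  then have "b - b' = b * (1 - a * b')"
    by (simp add: right_diff_distrib)
  also have "\<dots> = b * q' * (1 - a * b')"
    by (simp add: mult.assoc outer_inv_q_mult[OF b' q'])
  \<comment> \<open>Subtracting \<open>b * q = 0\<close> makes the difference of the idempotents
    appear.\<close>
  also have "\<dots> = b * (q' - q) * (1 - a * b')"
    by (simp add: right_diff_distrib outer_inv_mult_q[OF b])
  finally have "norm (b' - b) = norm (b * (q' - q) * (1 - a * b'))"
    by (metis norm_minus_commute)
  also have "\<dots> \<le> norm (b * (q' - q)) * (1 + norm (a * b'))"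
    by (rule norm_mult_one_minus_le)
  also have "\<dots> \<le> norm b * norm (q - q') * (1 + norm a * norm b')"
    by (intro mult_mono add_left_mono)
      (simp_all add: norm_mult_ineq norm_minus_commute[of q])
  finally show ?thesis .
qed

text \<open>The triangle inequality and the preceding estimate give an inequality linear in
  \<open>norm b'\<close>, which is solved for \<open>norm b'\<close>; \<open>small\<close> makes the
  divisor positive.\<close>

lemma norm_outer_inv_le:
  "norm b' \<le> (1 + norm (q - q')) / (1 - norm a * norm b * norm (q - q')) * norm b"
proof -
  have "norm b' \<le> norm b + norm (b' - b)"
    by (rule norm_triangle_sub)
  then have "norm b' * (1 - norm a * norm b * norm (q - q')) \<le> (1 + norm (q - q')) * norm b"
    using norm_outer_inv_diff_le_aux by (simp add: algebra_simps)
  then show ?thesis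
    using small by (simp add: pos_le_divide_eq)
qed

lemma norm_outer_inv_diff_le:
  "norm (b' - b) \<le> (1 + norm a * norm b) * norm (q - q') / (1 - norm a * norm b * norm (q - q')) * norm b"
    (is "_ \<le> ?R")
proof -
  have "norm (b' - b) \<le> norm b * norm (q - q') * (1 + norm a * norm b')"
    by (rule norm_outer_inv_diff_le_aux)
  also have "\<dots> \<le> norm b * norm (q - q') * (1 + norm a *
      ((1 + norm (q - q')) / (1 - norm a * norm b * norm (q - q')) * norm b))"
    by (intro mult_left_mono add_left_mono norm_outer_inv_le) simp_all
  \<comment> \<open>With \<kappa> = \<open>norm a * norm b\<close> and d =
    \<open>norm (q - q')\<close>, this is 1 + \<kappa>(1 + d)/(1 - \<kappa>d) = (1 + \<kappa>)/(1 -
    \<kappa>d).\<close>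
  also have "\<dots> = ?R"
    using small by (simp add: field_simps)
  finally show ?thesis .
qed

end

theorem theorem4p6:
  fixes a p q q' :: "'a::complex_banach_algebra_unit"
    and \<kappa> :: real
  assumes "p * p = p" and "q * q = q"
    and "\<exists>b. is_outer_inv_2l a p q b"
    and "\<kappa> = norm a * norm (outer_inv_2l a p q)"
    and "q' * q' = q'"
    and "norm (q - q') < 1 / (2 + \<kappa>)"
  shows "(\<exists>b. is_outer_inv_2l a p q' b) \<and>
    norm (outer_inv_2l a p q' - outer_inv_2l a p q) / norm (outer_inv_2l a p q)
      \<le> (1 + \<kappa>) * norm (q - q') / (1 - \<kappa> * norm (q - q')) \<and>
    norm (outer_inv_2l a p q')
      \<le> (1 + norm (q' - q)) / (1 - \<kappa> * norm (q' - q)) * norm (outer_inv_2l a p q) \<and>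
    (\<forall>w v. right_range w = right_range p \<and> right_range v = right_range p \<and>
        right_kernel w = right_range q \<and> right_kernel v = right_range q' \<longrightarrow>
      (\<exists>g. is_15_inverse (a * v) g) \<and>
      (\<forall>g. is_15_inverse (a * v) g \<longrightarrow>
        outer_inv_2l a p q' = outer_inv_2l a p q
          + outer_inv_2l a p q * g * a * (v - w) * (1 - a * outer_inv_2l a p q)))"
proof (intro conjI allI impI)
  let ?b = "outer_inv_2l a p q" and ?b' = "outer_inv_2l a p q'"
  have b: "is_outer_inv_2l a p q ?b"
    using assms(3) outer_inv_2l_eqI by metis
  have \<kappa>: "\<kappa> = norm a * norm ?b"
    by (rule assms(4))
  then have "\<kappa> \<ge> 0"
    by simp
  then have "norm (q - q') * (2 + \<kappa>) < 1"
    using assms(6) by (simp add: pos_less_divide_eq)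
  \<comment> \<open>The first bound serves existence, the second the positivity of the denominator 1
    - \<kappa> \<open>norm (q - q')\<close>.\<close>
  moreover have "norm (q - q') * (1 + \<kappa>) \<le> norm (q - q') * (2 + \<kappa>)"
    "\<kappa> * norm (q - q') \<le> norm (q - q') * (2 + \<kappa>)"
    by (simp_all add: algebra_simps)
  ultimately have small: "norm (q - q') * (1 + \<kappa>) < 1" "\<kappa> * norm (q - q') < 1"
    by linarith+
  show "\<exists>b. is_outer_inv_2l a p q' b"
    using outer_inv_perturbed_exists[OF b assms(2,5)] small(1) by (simp add: \<kappa>)
  then have b': "is_outer_inv_2l a p q' ?b'"
    using outer_inv_2l_eqI by metis
  have small': "norm a * norm ?b * norm (q - q') < 1"
    using small(2) by (simp add: \<kappa>)
  show "norm (?b' - ?b) / norm ?b \<le> (1 + \<kappa>) * norm (q - q') / (1 - \<kappa> * norm (q - q'))"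
  proof (cases "?b = 0")
    \<comment> \<open>Division by zero gives 0 on the left, while the right-hand side is
      nonnegative.\<close>
    case True
    then show ?thesis
      using \<open>\<kappa> \<ge> 0\<close> small(2) by simp
  next
    case False
    then show ?thesis
      using norm_outer_inv_diff_le[OF b b' assms(5) small'] by (simp add: \<kappa> pos_divide_le_eq)
  qed
  show "norm ?b' \<le> (1 + norm (q' - q)) / (1 - \<kappa> * norm (q' - q)) * norm ?b"
    using norm_outer_inv_le[OF b b' assms(5) small'] by (simp add: \<kappa> norm_minus_commute[of q'])
  fix w v
  assume "right_range w = right_range p \<and> right_range v = right_range p \<and>
    right_kernel w = right_range q \<and> right_kernel v = right_range q'"
  then have w: "right_kernel w = right_range q"
    and v: "right_range v = right_range p" "right_kernel v = right_range q'"
    by simp_all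
  show "\<exists>g. is_15_inverse (a * v) g"
    using outer_inv_15_inverse_exists[OF b' v] .
  fix g
  assume "is_15_inverse (a * v) g"
  then have g: "g * (a * v) = a * ?b'"
    by (rule outer_inv_15_inverse_mult[OF b' v])
  have "right_range ?b' = right_range p" and range_b: "right_range ?b = right_range p"
    using b b' by (simp_all add: is_outer_inv_2l_def)
  then have bab': "?b * (a * ?b') = ?b'"
    using outer_inv_mult_range[OF b] by simp
  have b'ab: "?b' * (a * ?b) = ?b"
    using outer_inv_mult_range[OF b' range_b] .
  \<comment> \<open>The kernel of \<open>w\<close> contains \<open>1 - a * ?b\<close>, so
    \<open>v - w\<close> reduces to \<open>v\<close> in front of this factor, and
    \<open>g * (a * v)\<close> can be replaced by \<open>a * ?b'\<close>.\<close>
  have "w * (1 - a * ?b) = 0"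
    using kernel_mult_outer_inv[OF b w] by (simp add: right_diff_distrib)
  then have "?b * g * a * (v - w) * (1 - a * ?b) = ?b * (g * (a * v)) * (1 - a * ?b)"
    by (simp add: right_diff_distrib[of _ v] left_diff_distrib[of _ _ "1 - a * ?b"] mult.assoc)
  also have "\<dots> = ?b' - ?b"
    by (simp add: g bab' b'ab right_diff_distrib)
  finally show "?b' = ?b + ?b * g * a * (v - w) * (1 - a * ?b)"
    by simp
qed

end
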